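(* Let $P=(p_1,p_2,\ldots)$ be a sequence of prime numbers. For each $k\in\mathbb{N}$ the limit mapping $h^k_P:\Sigma_P\to\Sigma_P$ is a finite-sheeted covering mapping, and its degree is at most $k$.
   Context: $\mathbb{N}$ is the set of positive integers; $1$ is not a prime. $\mathbb{S}^1$ is the unit circle in $\mathbb{C}$. For a sequence $P=(p_1,p_2,\ldots)$ of prime numbers, the $P$-adic solenoid is the inverse limit $\Sigma_P=\{(z_1,z_2,\ldots)\in\prod_{n\ge 1}\mathbb{S}^1 : z_{n+1}^{p_n}=z_n \text{ for all } n\in\mathbb{N}\}$ with the topology induced from the product topology. For $k\in\mathbb{N}$ the limit mapping $h^k_P:\Sigma_P\to\Sigma_P$ is $h^k_P((z_1,z_2,\ldots))=(z_1^k,z_2^k,\ldots)$. A surjective continuous mapping $f:X\to Y$ is a finite-sheeted covering mapping of degree $m\in\mathbb{N}$ if every point $y\in Y$ has an open neighborhood $W$ in $Y$ such that $f^{-1}(W)$ is the union of $m$ (pairwise) disjoint open subsets of $X$, each of which is mapped homeomorphically onto $W$ under $f$. *)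

theory Defs
  imports "HOL-Analysis.Analysis" "HOL-Computational_Algebra.Primes"
begin

(* Sequences are indexed from 0: P i and z i stand for p_(i+1) and z_(i+1). *)

definition solenoid :: "(nat \<Rightarrow> nat) \<Rightarrow> (nat \<Rightarrow> complex) set" where
  "solenoid P = {z. (\<forall>n. z n \<in> sphere 0 1) \<and> (\<forall>n. z (Suc n) ^ P n = z n)}"

(* The type nat => complex carries the product topology, so top_of_set (solenoid P) is the
   topology induced from the countable product of circles. *)
lemma top_of_set_solenoid:
  "top_of_set (solenoid P) =
     subtopology (product_topology (\<lambda>_::nat. top_of_set (sphere (0::complex) 1)) UNIV) (solenoid P)"
proof -
  have "product_topology (\<lambda>_::nat. top_of_set (sphere (0::complex) 1)) UNIV =
      top_of_set (PiE UNIV (\<lambda>_. sphere 0 1))"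
    by (simp add: subtopology_product_topology[symmetric] euclidean_product_topology)
  moreover have "PiE UNIV (\<lambda>_. sphere 0 1) \<inter> solenoid P = solenoid P"
    by (auto simp: solenoid_def PiE_def)
  ultimately show ?thesis
    by (simp add: subtopology_subtopology)
qed

(* Only the restriction to solenoid P is of interest; the formula does not depend on P. *)
definition limit_map :: "nat \<Rightarrow> (nat \<Rightarrow> complex) \<Rightarrow> (nat \<Rightarrow> complex)" where
  "limit_map k z = (\<lambda>n. z n ^ k)"

(* Compare covering_space, which neither bounds nor counts the sheets. *)
definition finite_sheeted_covering ::
    "nat \<Rightarrow> 'a::topological_space set \<Rightarrow> ('a \<Rightarrow> 'b::topological_space) \<Rightarrow> 'b set \<Rightarrow> bool" where
  "finite_sheeted_covering m X f Y \<longleftrightarrow>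
     m \<ge> 1 \<and> continuous_on X f \<and> f ` X = Y \<and>
     (\<forall>y\<in>Y. \<exists>W. y \<in> W \<and> openin (top_of_set Y) W \<and>
        (\<exists>V. finite V \<and> card V = m \<and> \<Union>V = X \<inter> f -` W \<and> pairwise disjnt V \<and>
             (\<forall>U\<in>V. openin (top_of_set X) U \<and> (\<exists>g. homeomorphism U W f g))))"

end

theory Submission imports Defs begin

(* The solenoid is a compact Hausdorff group and the limit map is a surjective homomorphism of it.
   Kernel elements are sequences of k-th roots of unity in which every coordinate determines the
   earlier ones, so finitely many of them are already told apart by a single coordinate N. Hence the
   kernel has at most k elements, and the translates by the kernel of a small neighbourhood,
   measured in coordinate N, are pairwise disjoint: these are the sheets. The degree of any covering
   is the cardinality of a fibre, here of the kernel. *)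

section \<open>Degree and fibre cardinality\<close>

text \<open>Every sheet over a neighbourhood of \<open>y\<close> contains exactly one preimage of
  \<open>y\<close>, so sheets and fibre points correspond. The degree is thus forced by the map,
  which lets a bound on one fibre bound every admissible \<open>m\<close>.\<close>

lemma finite_sheeted_covering_card_fibre:
  assumes "finite_sheeted_covering m X f Y" "y \<in> Y"
  shows "card (X \<inter> f -` {y}) = m"
proof -
  obtain W V where yW: "y \<in> W" and V: "finite V" "card V = m" "\<Union>V = X \<inter> f -` W" "pairwise disjnt V"
    and hom: "\<And>U. U \<in> V \<Longrightarrow> \<exists>g. homeomorphism U W f g"
    using assms unfolding finite_sheeted_covering_def by metis
  obtain g where g: "\<And>U. U \<in> V \<Longrightarrow> homeomorphism U W f (g U)"
    using hom by metis
  have gU: "g U y \<in> U" "f (g U y) = y" if "U \<in> V" for U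
    using g[OF that] yW by (auto simp: homeomorphism_def)
  have "bij_betw (\<lambda>U. g U y) V (X \<inter> f -` {y})"
    unfolding bij_betw_def
  proof
    show "inj_on (\<lambda>U. g U y) V"
    proof (rule inj_onI)
      fix A B assume "A \<in> V" "B \<in> V" "g A y = g B y"
      then have "\<not> disjnt A B"
        using gU(1) by (metis disjnt_iff)
      then show "A = B"
        using V(4) \<open>A \<in> V\<close> \<open>B \<in> V\<close> by (meson pairwiseD)
    qed
    have "x \<in> (\<lambda>U. g U y) ` V" if "x \<in> X" "f x = y" for x
    proof -
      have "x \<in> \<Union>V"
        using that yW by (simp add: V(3))
      then obtain U where U: "U \<in> V" "x \<in> U" ..
      then have "g U y = x"
        using g[OF U(1)] that by (auto simp: homeomorphism_def)
      then show ?thesis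
        using U by blast
    qed
    moreover have "g U y \<in> X" if "U \<in> V" for U
      using gU(1)[OF that] that V(3) by blast
    ultimately show "(\<lambda>U. g U y) ` V = X \<inter> f -` {y}"
      using gU(2) by auto
  qed
  then show ?thesis
    using V(2) by (simp add: bij_betw_same_card)
qed

section \<open>Group structure and the kernel\<close>

definition translate :: "(nat \<Rightarrow> complex) \<Rightarrow> (nat \<Rightarrow> complex) \<Rightarrow> (nat \<Rightarrow> complex)" where
  "translate a z = (\<lambda>n. a n * z n)"

definition limit_map_kernel :: "(nat \<Rightarrow> nat) \<Rightarrow> nat \<Rightarrow> (nat \<Rightarrow> complex) set" where
  "limit_map_kernel P k = {z \<in> solenoid P. limit_map k z = (\<lambda>_. 1)}"

lemma solenoid_nonzero: "z \<in> solenoid P \<Longrightarrow> z n \<noteq> 0"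
  by (auto simp: solenoid_def dest!: spec[of _ n])

lemma one_in_solenoid: "(\<lambda>_. 1) \<in> solenoid P"
  by (simp add: solenoid_def)

lemma translate_in_solenoid:
  "a \<in> solenoid P \<Longrightarrow> z \<in> solenoid P \<Longrightarrow> translate a z \<in> solenoid P"
  by (simp add: solenoid_def translate_def norm_mult power_mult_distrib)

lemma inverse_in_solenoid: "z \<in> solenoid P \<Longrightarrow> (\<lambda>n. inverse (z n)) \<in> solenoid P"
  by (simp add: solenoid_def norm_inverse power_inverse)

lemma limit_map_in_solenoid: "z \<in> solenoid P \<Longrightarrow> limit_map k z \<in> solenoid P"
  by (simp add: solenoid_def limit_map_def norm_power) (metis power_mult mult.commute)

lemma limit_map_translate: "limit_map k (translate a z) = translate (limit_map k a) (limit_map k z)"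
  by (simp add: limit_map_def translate_def power_mult_distrib)

text \<open>Fibres of a homomorphism are cosets of its kernel. The witness is the coordinatewise
  quotient of \<open>z\<close> by \<open>w\<close>, available because points of the circle are
  nonzero.\<close>

lemma limit_map_eq_iff:
  assumes "z \<in> solenoid P" "w \<in> solenoid P"
  shows "limit_map k z = limit_map k w \<longleftrightarrow> (\<exists>a \<in> limit_map_kernel P k. z = translate a w)"
proof
  assume eq: "limit_map k z = limit_map k w"
  define a where "a = translate z (\<lambda>n. inverse (w n))"
  have "z n ^ k = w n ^ k" for n
    using eq by (metis limit_map_def)
  then have "a \<in> limit_map_kernel P k" "z = translate a w"
    using assms solenoid_nonzero[OF assms(2)]
    by (simp_all add: limit_map_kernel_def a_def translate_in_solenoid inverse_in_solenoid)
       (simp_all add: limit_map_def translate_def power_mult_distrib power_inverse mult.assoc)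
  then show "\<exists>a \<in> limit_map_kernel P k. z = translate a w" by blast
next
  assume "\<exists>a \<in> limit_map_kernel P k. z = translate a w"
  then show "limit_map k z = limit_map k w"
    by (auto simp: limit_map_kernel_def limit_map_translate) (simp add: translate_def)
qed

section \<open>Continuity, compactness and surjectivity\<close>

lemma continuous_on_coordinate [continuous_intros]:
  "continuous_on S (\<lambda>z::nat \<Rightarrow> complex. z n)"
  by (rule continuous_on_subset[OF continuous_on_product_coordinates]) simp

lemma continuous_on_limit_map: "continuous_on S (limit_map k)"
  unfolding limit_map_def by (intro continuous_on_coordinatewise_then_product continuous_intros)

lemma continuous_on_translate: "continuous_on S (translate a)"
  unfolding translate_def by (intro continuous_on_coordinatewise_then_product continuous_intros)

text \<open>Tychonoff's theorem. The full product serves beyond the compactness of the solenoid: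
  approximate solutions in the surjectivity argument need not lie in the solenoid.\<close>

lemma compact_circle_sequences: "compact {z::nat \<Rightarrow> complex. \<forall>n. z n \<in> sphere 0 1}"
proof -
  have "compactin (product_topology (\<lambda>_. euclidean) UNIV) (PiE (UNIV::nat set) (\<lambda>_. sphere (0::complex) 1))"
    by (simp add: compactin_PiE)
  moreover have "PiE UNIV (\<lambda>_. sphere (0::complex) 1) = {z::nat \<Rightarrow> complex. \<forall>n. z n \<in> sphere 0 1}"
    by (auto simp: PiE_def)
  ultimately show ?thesis
    by (simp add: euclidean_product_topology)
qed

lemma compact_solenoid: "compact (solenoid P)"
proof -
  have "solenoid P = {z. \<forall>n. z n \<in> sphere 0 1} \<inter> {z. \<forall>n. z (Suc n) ^ P n = z n}"
    by (auto simp: solenoid_def)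
  moreover have "closed {z::nat \<Rightarrow> complex. \<forall>n. z (Suc n) ^ P n = z n}"
    by (intro closed_Collect_all closed_Collect_eq continuous_intros)
  ultimately show ?thesis
    using compact_circle_sequences by (simp add: compact_Int_closed)
qed

(* Each n-th stage can be solved by choosing a k-th root in coordinate n and powering down;
   compactness glues the stages together. *)
lemma limit_map_image_solenoid:
  assumes "k \<ge> 1"
  shows "limit_map k ` solenoid P = solenoid P"
proof
  show "limit_map k ` solenoid P \<subseteq> solenoid P"
    using limit_map_in_solenoid by blast
  show "solenoid P \<subseteq> limit_map k ` solenoid P"
  proof
    fix w assume w: "w \<in> solenoid P"
    \<comment> \<open>Coordinates beyond \<open>n\<close> are left free on the circle. The first
      \<open>n\<close> bonding relations link exactly the coordinates \<open>0\<close> to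
      \<open>n\<close>.\<close>
    define C where "C n = {z::nat \<Rightarrow> complex. \<forall>i. z i \<in> sphere 0 1} \<inter>
      {z. (\<forall>i<n. z (Suc i) ^ P i = z i) \<and> (\<forall>i\<le>n. z i ^ k = w i)}" for n
    have "closed {z::nat \<Rightarrow> complex. (\<forall>i. i < n \<longrightarrow> z (Suc i) ^ P i = z i) \<and> (\<forall>i. i \<le> n \<longrightarrow> z i ^ k = w i)}" for n
      by (intro closed_Collect_conj closed_Collect_all closed_Collect_imp closed_Collect_eq
          open_Collect_const continuous_intros)
    then have closed_C: "closed (C n)" for n
      unfolding C_def using compact_circle_sequences by (intro closed_Int compact_imp_closed) auto
    have nonempty_C: "C n \<noteq> {}" for n
    proof -
      \<comment> \<open>The top coordinate is prescribed arbitrarily so that the induction can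
        descend: a root \<open>r\<close> at stage \<open>Suc n\<close> passes the root
        \<open>r ^ P n\<close> down to stage \<open>n\<close>.\<close>
      have "\<exists>z\<in>C n. z n = r" if "r ^ k = w n" "r \<in> sphere 0 1" for r
        using that
      proof (induction n arbitrary: r)
        case 0
        then show ?case
          by (intro bexI[of _ "\<lambda>_. r"]) (auto simp: C_def)
      next
        case (Suc n)
        have "(r ^ P n) ^ k = w (Suc n) ^ P n"
          by (metis Suc.prems(1) mult.commute power_mult)
        also have "\<dots> = w n"
          using w by (simp add: solenoid_def)
        finally have "\<exists>z\<in>C n. z n = r ^ P n"
          using Suc.prems(2) by (intro Suc.IH) (auto simp: norm_power)
        then obtain z where z: "z \<in> C n" "z n = r ^ P n" ..
        \<comment> \<open>Overwriting coordinate \<open>Suc n\<close> keeps the earlier conditions,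
          which do not involve it, and the choice of \<open>z n\<close> supplies the new bonding
          relation.\<close>
        then show ?case
          using Suc.prems
          by (intro bexI[of _ "z(Suc n := r)"]) (auto simp: C_def less_Suc_eq le_Suc_eq)
      qed
      moreover obtain r where r: "r ^ k = w n"
        using exists_complex_root[of k "w n"] assms by (metis not_one_le_zero)
      moreover have "norm r ^ k = 1"
        using r w by (simp add: solenoid_def flip: norm_power)
      then have "r \<in> sphere 0 1"
        using power_eq_1_iff[of "norm r" k] assms by simp
      ultimately show ?thesis
        by blast
    qed
    have antimono_C: "C n \<subseteq> C m" if "m \<le> n" for m n
      using that by (auto simp: C_def)
    have "{z::nat \<Rightarrow> complex. \<forall>i. z i \<in> sphere 0 1} \<inter> \<Inter> (range C) \<noteq> {}"
    proof (rule compact_imp_fip_image[OF compact_circle_sequences closed_C])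
      fix I :: "nat set" assume "finite I"
      then obtain n where "I \<subseteq> {..n}"
        using finite_nat_iff_bounded_le by blast
      then have "C n \<subseteq> \<Inter> (C ` I)"
        using antimono_C by blast
      moreover have "C n \<subseteq> {z. \<forall>i. z i \<in> sphere 0 1}"
        by (simp add: C_def)
      ultimately show "{z. \<forall>i. z i \<in> sphere 0 1} \<inter> \<Inter> (C ` I) \<noteq> {}"
        using nonempty_C[of n] by blast
    qed
    then obtain z where "\<And>n. z \<in> C n"
      by blast
    then have "z \<in> solenoid P" "limit_map k z = w"
      by (auto simp: C_def solenoid_def limit_map_def)
    then show "w \<in> limit_map k ` solenoid P"
      by blast
  qed
qed

section \<open>Separation by one coordinate and the size of the kernel\<close>

text \<open>Each coordinate is a power of the next, so equality propagates downwards.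
  Contrapositively, two points that differ at one index differ at all later ones.\<close>

lemma solenoid_coordinates_agree_below:
  assumes "z \<in> solenoid P" "w \<in> solenoid P" "z n = w n" "m \<le> n"
  shows "z m = w m"
  using assms(4,3)
proof (induction rule: inc_induct)
  case (step i)
  then show ?case
    using assms(1,2) by (simp add: solenoid_def) metis
qed

text \<open>Each pair of distinct points is separated at all sufficiently large indices; finitely
  many pairs therefore share a separating index.\<close>

lemma finite_subset_solenoid_separated:
  assumes "F \<subseteq> solenoid P" "finite F"
  obtains N where "inj_on (\<lambda>z. z N) F"
proof -
  have "\<forall>\<^sub>F N in sequentially. z N = w N \<longrightarrow> z = w" if zw: "z \<in> F" "w \<in> F" for z w
  proof (cases "z = w")
    case False
    then obtain n where "z n \<noteq> w n"
      by blast
    then show ?thesis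
      using zw assms(1) solenoid_coordinates_agree_below unfolding eventually_sequentially by blast
  qed simp
  then have "\<forall>\<^sub>F N in sequentially. \<forall>z\<in>F. \<forall>w\<in>F. z N = w N \<longrightarrow> z = w"
    using assms(2) by (intro eventually_ball_finite ballI)
  then show ?thesis
    using that eventually_happens'[OF sequentially_bot] unfolding inj_on_def by blast
qed

text \<open>A separating coordinate is available only for finite sets, so the bound is proved for
  finite subsets of the kernel first: such a coordinate injects them into the \<open>k\<close>-th
  roots of unity.\<close>

lemma limit_map_kernel_finite_card:
  assumes "k \<ge> 1"
  shows "finite (limit_map_kernel P k) \<and> card (limit_map_kernel P k) \<le> k"
proof (rule finite_if_finite_subsets_card_bdd)
  fix F assume F: "F \<subseteq> limit_map_kernel P k" "finite F"
  then have "F \<subseteq> solenoid P"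
    by (auto simp: limit_map_kernel_def)
  then obtain N where "inj_on (\<lambda>z. z N) F"
    using finite_subset_solenoid_separated F(2) by blast
  moreover have "(\<lambda>z. z N) ` F \<subseteq> {z. z ^ k = 1}"
    using F(1) by (auto simp: limit_map_kernel_def limit_map_def fun_eq_iff)
  moreover have "finite {z::complex. z ^ k = 1}"
    using assms finite_roots_unity by blast
  ultimately have "card F \<le> card {z::complex. z ^ k = 1}"
    by (rule card_inj_on_le)
  also have "\<dots> \<le> k"
    using assms by (rule card_roots_unity)
  finally show "card F \<le> k" .
qed

section \<open>Openness of translations and of the limit map\<close>

lemma openin_translate_image:
  assumes "a \<in> solenoid P" "openin (top_of_set (solenoid P)) A"
  shows "openin (top_of_set (solenoid P)) (translate a ` A)"
proof -
  let ?b = "\<lambda>n. inverse (a n)"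
  have AP: "A \<subseteq> solenoid P"
    using assms(2) by (rule openin_imp_subset)
  have b: "?b \<in> solenoid P"
    using assms(1) by (rule inverse_in_solenoid)
  have "translate ?b (translate a z) = z" "translate a (translate ?b z) = z" for z
    using solenoid_nonzero[OF assms(1)] by (simp_all add: translate_def flip: mult.assoc)
  then have "translate a ` A = solenoid P \<inter> translate ?b -` A"
    using AP translate_in_solenoid[OF assms(1)] by (auto simp: image_iff) metis
  moreover have "translate ?b \<in> solenoid P \<rightarrow> solenoid P"
    using translate_in_solenoid[OF b] by blast
  ultimately show ?thesis
    using continuous_openin_preimage[OF continuous_on_translate _ assms(2)] by simp
qed

(* The complement of the image is the image of the complement of the saturation by the kernel. *)
lemma limit_map_open:
  assumes "k \<ge> 1" "openin (top_of_set (solenoid P)) A"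
  shows "openin (top_of_set (solenoid P)) (limit_map k ` A)"
proof -
  define S where "S = (\<Union>a\<in>limit_map_kernel P k. translate a ` A)"
  have AP: "A \<subseteq> solenoid P"
    using assms(2) by (rule openin_imp_subset)
  have "openin (top_of_set (solenoid P)) S"
    unfolding S_def using assms(2)
    by (intro openin_Union) (auto simp: limit_map_kernel_def intro: openin_translate_image)
  then have "closedin (top_of_set (solenoid P)) (solenoid P - S)"
    using closedin_diff[OF closedin_topspace] by fastforce
  then have "compact (solenoid P - S)"
    using compact_solenoid closedin_compact by blast
  then have "closed (limit_map k ` (solenoid P - S))"
    by (intro compact_imp_closed compact_continuous_image continuous_on_limit_map)
  then have "openin (top_of_set (solenoid P)) (solenoid P - limit_map k ` (solenoid P - S))"
    by (metis Diff_eq openin_open_Int open_Compl)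
  \<comment> \<open>Saturation: whether a point lies in \<open>S\<close> depends only on its image,
    so \<open>S\<close> and its complement have disjoint images.\<close>
  moreover have S: "z \<in> S \<longleftrightarrow> limit_map k z \<in> limit_map k ` A" if "z \<in> solenoid P" for z
    using limit_map_eq_iff[OF that] AP unfolding S_def by blast
  have "limit_map k ` A = solenoid P - limit_map k ` (solenoid P - S)"
  proof (intro equalityI subsetI)
    fix y assume "y \<in> solenoid P - limit_map k ` (solenoid P - S)"
    moreover from this obtain z where "z \<in> solenoid P" "y = limit_map k z"
      using limit_map_image_solenoid[OF assms(1), of P] by blast
    ultimately show "y \<in> limit_map k ` A"
      using S by blast
  next
    fix y assume y: "y \<in> limit_map k ` A"
    then have "y \<notin> limit_map k ` (solenoid P - S)"
      using S by blast
    then show "y \<in> solenoid P - limit_map k ` (solenoid P - S)"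
      using y AP limit_map_in_solenoid by blast
  qed
  ultimately show ?thesis
    by simp
qed

section \<open>Construction of the sheets\<close>

lemma finite_separation:
  fixes f :: "'a \<Rightarrow> 'b::metric_space"
  assumes "finite F" "inj_on f F"
  obtains e where "e > 0" "\<And>x y. x \<in> F \<Longrightarrow> y \<in> F \<Longrightarrow> dist (f x) (f y) < e \<Longrightarrow> x = y"
proof -
  have "\<forall>\<^sub>F e in at_right (0::real). dist (f x) (f y) < e \<longrightarrow> x = y" if xy: "x \<in> F" "y \<in> F" for x y
  proof (cases "x = y")
    case False
    then have "dist (f x) (f y) > 0"
      using assms(2) xy by (auto simp: inj_on_def)
    then show ?thesis
      unfolding eventually_at_right_field by (intro exI[of _ "dist (f x) (f y)"]) auto
  qed simp
  then have "\<forall>\<^sub>F e in at_right (0::real). \<forall>x\<in>F. \<forall>y\<in>F. dist (f x) (f y) < e \<longrightarrow> x = y"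
    using assms(1) by (intro eventually_ball_finite ballI)
  then have "\<forall>\<^sub>F e in at_right (0::real). e > 0 \<and> (\<forall>x\<in>F. \<forall>y\<in>F. dist (f x) (f y) < e \<longrightarrow> x = y)"
    using eventually_at_right_less by eventually_elim blast
  from eventually_happens'[OF trivial_limit_at_right_real this]
  obtain e where "e > 0 \<and> (\<forall>x\<in>F. \<forall>y\<in>F. dist (f x) (f y) < e \<longrightarrow> x = y)" ..
  then show ?thesis
    using that by blast
qed

lemma limit_map_finite_sheeted_covering:
  assumes k: "k \<ge> 1"
  shows "finite_sheeted_covering (card (limit_map_kernel P k)) (solenoid P) (limit_map k) (solenoid P)"
  unfolding finite_sheeted_covering_def
proof (intro conjI ballI)
  let ?K = "limit_map_kernel P k" and ?S = "solenoid P" and ?h = "limit_map k"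
  have finK: "finite ?K" and KS: "?K \<subseteq> ?S"
    using limit_map_kernel_finite_card[OF k] by (auto simp: limit_map_kernel_def)
  have "(\<lambda>_. 1) \<in> ?K"
    by (simp add: limit_map_kernel_def one_in_solenoid limit_map_def)
  then show "1 \<le> card ?K"
    using finK by (metis One_nat_def Suc_leI card_gt_0_iff empty_iff)
  show "continuous_on ?S ?h"
    by (rule continuous_on_limit_map)
  show "?h ` ?S = ?S"
    using k by (rule limit_map_image_solenoid)
  obtain N where "inj_on (\<lambda>z. z N) ?K"
    using finite_subset_solenoid_separated[OF KS finK] .
  then obtain e where e: "e > 0" "\<And>a b. a \<in> ?K \<Longrightarrow> b \<in> ?K \<Longrightarrow> dist (a N) (b N) < e \<Longrightarrow> a = b"
    using finite_separation[OF finK] by metis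
  fix y assume "y \<in> ?S"
  then obtain x where x: "x \<in> ?S" "?h x = y"
    using limit_map_image_solenoid[OF k, of P] by (metis imageE)
  \<comment> \<open>The radius is half the separation of the kernel at \<open>N\<close>, leaving
    room for one triangle inequality.\<close>
  define U where "U = ?S \<inter> {z. dist (z N) (x N) < e / 2}"
  have "open {z::nat \<Rightarrow> complex. dist (z N) (x N) < e / 2}"
    by (intro open_Collect_less continuous_intros)
  then have openU: "openin (top_of_set ?S) U"
    unfolding U_def by (rule openin_open_Int)
  have xU: "x \<in> U" and US: "U \<subseteq> ?S"
    using x e by (auto simp: U_def)
  \<comment> \<open>Multiplication by a unit complex number preserves distance, so
    \<open>a N * x N\<close> and \<open>b N * x N\<close> are both within \<open>e / 2\<close> of
    the common value \<open>a N * u N\<close>. This gives disjointness of the sheets, their number,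
    and injectivity on each.\<close>
  have same: "a = b" if "a \<in> ?K" "b \<in> ?K" "u \<in> U" "v \<in> U" "translate a u = translate b v" for a b u v
  proof -
    have norm_1: "norm (z N) = 1" if "z \<in> ?S" for z
      using that by (simp add: solenoid_def)
    have near: "dist (c N * z N) (c N * x N) < e / 2" if "c \<in> ?K" "z \<in> U" for c z
      using that norm_1 KS unfolding U_def
      by (auto simp: dist_norm norm_mult subset_iff simp flip: right_diff_distrib)
    have "dist (a N) (b N) = norm (a N - b N) * norm (x N)"
      using norm_1[OF x(1)] by (simp add: dist_norm)
    also have "\<dots> = dist (a N * x N) (b N * x N)"
      by (simp add: dist_norm left_diff_distrib flip: norm_mult)
    also have "\<dots> < e"
    proof (rule dist_triangle_half_r)
      show "dist (a N * u N) (a N * x N) < e / 2"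
        using near that by blast
      have "a N * u N = b N * v N"
        using that(5) by (metis translate_def)
      then show "dist (a N * u N) (b N * x N) < e / 2"
        using near[OF that(2,4)] by simp
    qed
    finally show ?thesis
      using e that by blast
  qed
  define V where "V = (\<lambda>a. translate a ` U) ` ?K"
  have hK: "?h (translate a z) = ?h z" if "a \<in> ?K" "z \<in> ?S" for a z
    using that KS limit_map_eq_iff translate_in_solenoid by blast
  show "\<exists>W. y \<in> W \<and> openin (top_of_set ?S) W \<and>
        (\<exists>V. finite V \<and> card V = card ?K \<and> \<Union>V = ?S \<inter> ?h -` W \<and> pairwise disjnt V \<and>
             (\<forall>U\<in>V. openin (top_of_set ?S) U \<and> (\<exists>g. homeomorphism U W ?h g)))"
  proof (rule exI[of _ "?h ` U"], intro conjI exI[of _ V] ballI)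
    show "y \<in> ?h ` U"
      using x xU by blast
    show "openin (top_of_set ?S) (?h ` U)"
      using k openU by (rule limit_map_open)
    show "finite V"
      using finK by (simp add: V_def)
    \<comment> \<open>Since \<open>U\<close> contains \<open>x\<close>, equal translates share a
      point, so distinct kernel elements give distinct members of \<open>V\<close>.\<close>
    have "inj_on (\<lambda>a. translate a ` U) ?K"
      using same xU by (intro inj_onI) (metis image_iff)
    then show "card V = card ?K"
      unfolding V_def by (rule card_image)
    show "\<Union>V = ?S \<inter> ?h -` (?h ` U)"
    proof
      show "\<Union>V \<subseteq> ?S \<inter> ?h -` (?h ` U)"
      proof
        fix z assume "z \<in> \<Union>V"
        then obtain a u where "a \<in> ?K" "u \<in> U" "z = translate a u"
          by (auto simp: V_def)
        then show "z \<in> ?S \<inter> ?h -` (?h ` U)"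
          using hK[of a u] translate_in_solenoid[of a P u] KS US by auto
      qed
      show "?S \<inter> ?h -` (?h ` U) \<subseteq> \<Union>V"
      proof
        fix z assume "z \<in> ?S \<inter> ?h -` (?h ` U)"
        then obtain u where "u \<in> U" "?h z = ?h u" "z \<in> ?S"
          by auto
        then show "z \<in> \<Union>V"
          using limit_map_eq_iff[of z P u k] US by (auto simp: V_def)
      qed
    qed
    show "pairwise disjnt V"
      unfolding V_def pairwise_def disjnt_iff using same by blast
    fix A assume "A \<in> V"
    then obtain a where a: "a \<in> ?K" "A = translate a ` U"
      by (auto simp: V_def)
    show openA: "openin (top_of_set ?S) A"
      using a KS openU openin_translate_image by blast
    show "\<exists>g. homeomorphism A (?h ` U) ?h g"
    proof -
      have hA: "?h ` A = ?h ` U"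
        using hK[OF a(1)] US by (force simp: a(2) image_iff)
      have "inj_on ?h A"
      proof (rule inj_onI)
        fix s t assume st: "s \<in> A" "t \<in> A" "?h s = ?h t"
        obtain u v where uv: "u \<in> U" "v \<in> U" "s = translate a u" "t = translate a v"
          using st a by blast
        have "?h u = ?h v"
          using st(3) uv hK[OF a(1)] US by (simp add: subset_iff)
        then obtain b where b: "b \<in> ?K" "u = translate b v"
          using limit_map_eq_iff uv US by blast
        \<comment> \<open>Writing \<open>u\<close> as its translate by the identity brings
          \<open>same\<close> into play: two points of \<open>U\<close> in one fibre differ by a
          trivial kernel element.\<close>
        have "translate (\<lambda>_. 1) u = translate b v"
          using b by (simp add: translate_def)
        then have "b = (\<lambda>_. 1)"
          using same b uv \<open>(\<lambda>_. 1) \<in> ?K\<close> by metis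
        then show "s = t"
          using b uv by (simp add: translate_def)
      qed
      \<comment> \<open>An open subset of the open sheet \<open>A\<close> is open in the solenoid,
        so openness of the limit map applies and then restricts to the image of
        \<open>U\<close>.\<close>
      moreover have "openin (top_of_set (?h ` U)) (?h ` B)" if "openin (top_of_set A) B" for B
      proof -
        have "openin (top_of_set ?S) (?h ` B)"
          using that openA k limit_map_open openin_trans by blast
        moreover have "?h ` B \<subseteq> ?h ` U"
          using that hA openin_imp_subset by blast
        ultimately show ?thesis
          using openin_subset_trans US limit_map_in_solenoid by (metis image_subset_iff subset_iff)
      qed
      ultimately show ?thesis
        using homeomorphism_injective_open_map[OF continuous_on_limit_map hA] by metis
    qed
  qed
qed

theorem proposition1:
  fixes P :: "nat \<Rightarrow> nat" and k :: nat
  assumes "\<And>n. prime (P n)" and "k \<ge> 1"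
  shows "(\<exists>m. finite_sheeted_covering m (solenoid P) (limit_map k) (solenoid P)) \<and>
         (\<forall>m. finite_sheeted_covering m (solenoid P) (limit_map k) (solenoid P) \<longrightarrow> m \<le> k)"
proof (intro conjI allI impI)
  show "\<exists>m. finite_sheeted_covering m (solenoid P) (limit_map k) (solenoid P)"
    using limit_map_finite_sheeted_covering[OF assms(2)] by blast
  fix m assume "finite_sheeted_covering m (solenoid P) (limit_map k) (solenoid P)"
  \<comment> \<open>The fibre over the identity is the kernel itself, so the kernel bound applies
    without counting a coset.\<close>
  then have "card (solenoid P \<inter> limit_map k -` {\<lambda>_. 1}) = m"
    using one_in_solenoid by (rule finite_sheeted_covering_card_fibre)
  moreover have "solenoid P \<inter> limit_map k -` {\<lambda>_. 1} = limit_map_kernel P k"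
    by (auto simp: limit_map_kernel_def)
  ultimately show "m \<le> k"
    using limit_map_kernel_finite_card[OF assms(2), of P] by simp
qed

end
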